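(* Let $n \geqslant 1$ be an integer and let $F_n = 2^{2^n} + 1$. Define a sequence of integers by $S_0 = 5$ and $S_i = S_{i-1}^2 - 2$ for $i = 1, 2, 3, \ldots, 2^n - 2$. Then $F_n$ is prime if and only if $F_n$ divides $S_{2^n - 2}$.
   Context: $F_n = 2^{2^n}+1$ is the $n$-th Fermat number. For $n = 1$ the index $2^n-2$ equals $0$, so the relevant term is $S_0 = 5$. *)

theory Defs
  imports "HOL-Number_Theory.Number_Theory"
begin

definition fermat_number :: "nat \<Rightarrow> nat" where
  "fermat_number n = 2 ^ (2 ^ n) + 1"

end

theory Submission
  imports Defs
begin

text \<open>
  The map \<open>x \<mapsto> x\<^sup>2 - 2\<close> sends \<open>a + 1/a\<close> to \<open>a\<^sup>2 + 1/a\<^sup>2\<close>, so with \<open>a\<close> a root of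
  \<open>X\<^sup>2 - 5 X + 1\<close>, that is \<open>a = (5 + \<surd>21) / 2\<close>, one has \<open>S i = a ^ (2 ^ i) + 1 / a ^ (2 ^ i)\<close>.
  Write \<open>F\<close> for the Fermat number and put \<open>r = 2 ^ n - 2\<close>, so that \<open>F - 1 = 4 * 2 ^ r\<close>.  As \<open>a\<close> is a
  unit, \<open>F\<close> divides \<open>S r\<close> iff \<open>a ^ ((F - 1) / 2) = -1\<close> in \<open>\<int>[a] / F\<close>.

  If \<open>F\<close> is prime, quadratic reciprocity makes 3 and 7 nonresidues, so 21 is a square modulo \<open>F\<close>
  and \<open>a\<close> can be taken in the prime field.  There \<open>12 a = (3 + \<surd>21)\<^sup>2\<close>, so \<open>a\<close> differs from the
  nonresidue 3 by a square factor, and Euler's criterion gives \<open>a ^ ((F - 1) / 2) = -1\<close>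
  (\<open>lucas_test_if_prime\<close>).

  If conversely \<open>a ^ ((F - 1) / 2) = -1\<close>, this persists modulo every divisor \<open>x > 1\<close> of \<open>F\<close>; such an \<open>x\<close>
  is odd, so the order of \<open>a\<close> modulo \<open>x\<close> is exactly the power of two \<open>F - 1\<close>.  But \<open>\<int>[a] / x\<close> has
  only \<open>x\<^sup>2 - 1\<close> nonzero elements, so \<open>F - 1 < x\<^sup>2\<close>
  (\<open>power_two_less_square_if_dvd_lucas_V\<close>).  A composite \<open>F\<close> would have a divisor with \<open>x\<^sup>2 \<le> F\<close>,
  hence \<open>x\<^sup>2 = F\<close>, which is impossible because \<open>F - 1\<close> is a positive square
  (\<open>prime_if_lucas_test\<close>).

  The ring \<open>\<int>[a]\<close> enters only through the coordinates of the powers of \<open>a\<close>, which are consecutive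
  terms of a Lucas sequence: \<open>a ^ k = U k * a - U (k - 1)\<close>.
\<close>

section \<open>Lucas sequences\<close>

text \<open>
  The Lucas sequences of the first and second kind with parameters \<open>(P, 1)\<close>.  For a root \<open>a\<close> of
  \<open>X\<^sup>2 - P X + 1\<close> with conjugate \<open>b = 1/a \<noteq> a\<close>, they are \<open>(a ^ k - b ^ k) / (a - b)\<close> and \<open>a ^ k + b ^ k\<close>.
\<close>

fun lucas_U :: "int \<Rightarrow> nat \<Rightarrow> int" where
  "lucas_U P 0 = 0"
| "lucas_U P (Suc 0) = 1"
| "lucas_U P (Suc (Suc k)) = P * lucas_U P (Suc k) - lucas_U P k"

definition lucas_V :: "int \<Rightarrow> nat \<Rightarrow> int" where
  "lucas_V P k = 2 * lucas_U P (Suc k) - P * lucas_U P k"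

text \<open>
  The left-hand side is the norm of \<open>a ^ k\<close> and the norm of \<open>a\<close> is 1.  It implies that consecutive
  terms of \<open>U\<close> never vanish together modulo \<open>m > 1\<close>.
\<close>

lemma lucas_U_norm:
  "(lucas_U P (Suc k))\<^sup>2 - P * lucas_U P k * lucas_U P (Suc k) + (lucas_U P k)\<^sup>2 = 1"
  by (induction k) (auto simp: power2_eq_square algebra_simps)

text \<open>
  The two coordinates of \<open>a ^ (m + k) = a ^ m * a ^ k\<close>.
\<close>

lemma lucas_U_add:
  "lucas_U P (m + k) =
     lucas_U P m * lucas_U P (Suc k) + lucas_U P (Suc m) * lucas_U P k
     - P * lucas_U P m * lucas_U P k"
  "lucas_U P (Suc (m + k)) = lucas_U P (Suc m) * lucas_U P (Suc k) - lucas_U P m * lucas_U P k"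
proof (induction m)
  case (Suc m)
  show "lucas_U P (Suc m + k) =
     lucas_U P (Suc m) * lucas_U P (Suc k) + lucas_U P (Suc (Suc m)) * lucas_U P k
     - P * lucas_U P (Suc m) * lucas_U P k"
    using Suc(2) by (simp add: algebra_simps)
  have "lucas_U P (Suc (Suc m + k)) = P * lucas_U P (Suc (m + k)) - lucas_U P (m + k)"
    by simp
  also have "\<dots> = lucas_U P (Suc (Suc m)) * lucas_U P (Suc k) - lucas_U P (Suc m) * lucas_U P k"
    unfolding Suc by (simp add: algebra_simps)
  finally show "lucas_U P (Suc (Suc m + k)) =
      lucas_U P (Suc (Suc m)) * lucas_U P (Suc k) - lucas_U P (Suc m) * lucas_U P k" .
qed simp_all

text \<open>
  The coordinates of \<open>a ^ (2 * k) = a ^ k * (a ^ k + b ^ k) - 1\<close>; thus \<open>a ^ (2 * k) = -1\<close> modulo any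
  divisor of \<open>V k\<close>.
\<close>

lemma lucas_U_double:
  "lucas_U P (2 * k) = lucas_U P k * lucas_V P k"
  "lucas_U P (Suc (2 * k)) = lucas_U P (Suc k) * lucas_V P k - 1"
proof -
  show "lucas_U P (2 * k) = lucas_U P k * lucas_V P k"
    using lucas_U_add(1)[of P k k] unfolding mult_2[of k] by (simp add: lucas_V_def algebra_simps)
  have "lucas_U P (Suc (2 * k)) = (lucas_U P (Suc k))\<^sup>2 - (lucas_U P k)\<^sup>2"
    using lucas_U_add(2)[of P k k] unfolding mult_2[of k] by (simp add: power2_eq_square)
  with lucas_U_norm[of P k] show "lucas_U P (Suc (2 * k)) = lucas_U P (Suc k) * lucas_V P k - 1"
    by (simp add: lucas_V_def power2_eq_square algebra_simps)
qed

lemma lucas_V_double: "lucas_V P (2 * k) = (lucas_V P k)\<^sup>2 - 2"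
proof -
  have "lucas_V P (2 * k) = lucas_V P k * (2 * lucas_U P (Suc k) - P * lucas_U P k) - 2"
    unfolding lucas_V_def[of P "2 * k"] lucas_U_double by (simp add: algebra_simps)
  then show ?thesis
    by (simp add: lucas_V_def power2_eq_square)
qed

section \<open>Periods of Lucas sequences\<close>

text \<open>
  The condition says that \<open>a ^ k = 1\<close> in \<open>\<int>[a] / m\<close>: since the recursion determines \<open>U\<close> from two
  neighbouring terms, it is enough that these return to their initial values.
\<close>

definition lucas_period :: "int \<Rightarrow> int \<Rightarrow> nat \<Rightarrow> bool" where
  "lucas_period P m k \<longleftrightarrow> [lucas_U P k = 0] (mod m) \<and> [lucas_U P (Suc k) = 1] (mod m)"

lemma lucas_U_add_period:
  assumes "lucas_period P m d"
  shows "[lucas_U P (k + d) = lucas_U P k] (mod m)"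
    and "[lucas_U P (Suc (k + d)) = lucas_U P (Suc k)] (mod m)"
proof -
  have U: "[lucas_U P d = 0] (mod m)" "[lucas_U P (Suc d) = 1] (mod m)"
    using assms by (auto simp: lucas_period_def)
  have "[lucas_U P (k + d) =
      lucas_U P k * 1 + lucas_U P (Suc k) * 0 - P * lucas_U P k * 0] (mod m)"
    unfolding lucas_U_add by (intro cong_add cong_diff cong_mult cong_refl U)
  then show "[lucas_U P (k + d) = lucas_U P k] (mod m)" by simp
  have "[lucas_U P (Suc (k + d)) = lucas_U P (Suc k) * 1 - lucas_U P k * 0] (mod m)"
    unfolding lucas_U_add by (intro cong_add cong_diff cong_mult cong_refl U)
  then show "[lucas_U P (Suc (k + d)) = lucas_U P (Suc k)] (mod m)" by simp
qed

lemma lucas_period_add_iff: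
  "lucas_period P m d \<Longrightarrow> lucas_period P m (k + d) \<longleftrightarrow> lucas_period P m k"
  using lucas_U_add_period[of P m d k] by (auto simp: lucas_period_def cong_def)

lemma lucas_period_mult: "lucas_period P m d \<Longrightarrow> lucas_period P m (j * d)"
proof (induction j)
  case 0
  show ?case by (simp add: lucas_period_def)
next
  case (Suc j)
  then show ?case using lucas_period_add_iff[of P m d "j * d"] by (simp add: add.commute)
qed

text \<open>
  Bezout: the periods are the natural numbers in an ideal of \<open>\<int>\<close>, whose generator is the order
  of \<open>a\<close> modulo \<open>m\<close>.
\<close>

lemma lucas_period_gcd:
  assumes "lucas_period P m k" "lucas_period P m l"
  shows "lucas_period P m (gcd k l)"
proof (cases "k = 0")
  case False
  then obtain x y where "k * x = l * y + gcd k l"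
    using bezout_nat by blast
  then have "x * k = gcd k l + y * l"
    by (simp add: mult.commute)
  then have "lucas_period P m (gcd k l + y * l)"
    using lucas_period_mult[OF assms(1), of x] by simp
  then show ?thesis
    using lucas_period_add_iff[OF lucas_period_mult[OF assms(2)]] by blast
qed (use assms in simp)

text \<open>
  Because the coefficient \<open>Q = 1\<close> is a unit, the recursion can be run backwards, so a repetition
  anywhere in the sequence can be pulled back to the start.
\<close>

lemma lucas_period_diff:
  assumes "[lucas_U P i = lucas_U P (i + d)] (mod m)"
    and "[lucas_U P (Suc i) = lucas_U P (Suc (i + d))] (mod m)"
  shows "lucas_period P m d"
  using assms
proof (induction i)
  case 0
  then show ?case by (auto simp: lucas_period_def cong_sym_eq)
next
  case (Suc i)
  have backwards: "lucas_U P k = P * lucas_U P (Suc k) - lucas_U P (Suc (Suc k))" for k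
    by simp
  have "[lucas_U P i = lucas_U P (i + d)] (mod m)"
    unfolding backwards[of i] backwards[of "i + d"]
    using Suc.prems by (intro cong_diff cong_mult cong_refl) simp_all
  then show ?case
    using Suc by simp
qed

text \<open>
  Pigeonhole: the residues of two neighbouring terms form a pair different from \<open>(0, 0)\<close>, so at most
  \<open>m\<^sup>2 - 1\<close> such pairs occur.  Omitting \<open>(0, 0)\<close> makes the bound on the period strict, which
  \<open>prime_if_lucas_test\<close> depends on.
\<close>

lemma lucas_period_exists:
  assumes "m > 1"
  shows "\<exists>d. 0 < d \<and> d < m\<^sup>2 \<and> lucas_period P (int m) d"
proof -
  define f where "f k = (lucas_U P k mod int m, lucas_U P (Suc k) mod int m)" for k
  define B where "B = {0..<int m} \<times> {0..<int m} - {(0, 0)}"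
  have "f k \<in> B" for k
  proof -
    have "f k \<noteq> (0, 0)"
    proof
      assume "f k = (0, 0)"
      then have "int m dvd lucas_U P k" "int m dvd lucas_U P (Suc k)"
        by (auto simp: f_def)
      then have "int m dvd (lucas_U P (Suc k))\<^sup>2 - P * lucas_U P k * lucas_U P (Suc k) + (lucas_U P k)\<^sup>2"
        by (simp add: power2_eq_square)
      then show False
        unfolding lucas_U_norm using assms by simp
    qed
    then show ?thesis using assms by (auto simp: B_def f_def)
  qed
  then have "f ` {..<m\<^sup>2} \<subseteq> B" by blast
  moreover have "card B < card {..<m\<^sup>2}"
    using assms by (simp add: B_def card_Diff_subset power2_eq_square)
  moreover have "finite B" by (simp add: B_def)
  ultimately have "\<not> inj_on f {..<m\<^sup>2}"
    by (meson card_inj_on_le not_less)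
  then obtain i j where ij: "i < j" "j < m\<^sup>2" "f i = f j"
    by (metis (no_types, lifting) inj_onI lessThan_iff nat_neq_iff)
  then have "lucas_period P (int m) (j - i)"
    by (intro lucas_period_diff[of P i]) (auto simp: f_def cong_def)
  with ij show ?thesis
    by (intro exI[of _ "j - i"]) auto
qed

text \<open>
  The hypothesis means \<open>a ^ 2 ^ (s + 1) = -1\<close> modulo \<open>m\<close>, which is not 1 as \<open>m > 2\<close>.  So
  \<open>2 ^ (s + 2)\<close> is a period and its half is not, which forces the least period to be
  \<open>2 ^ (s + 2)\<close>, and the least period is below \<open>m\<^sup>2\<close>.
\<close>

lemma power_two_less_square_if_dvd_lucas_V:
  assumes "m > 2" and "int m dvd lucas_V P (2 ^ s)"
  shows "2 ^ (s + 2) < m\<^sup>2"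
proof (rule ccontr)
  let ?h = "2 ^ (s + 1) :: nat" and ?N = "2 ^ (s + 2) :: nat"
  assume small: "\<not> ?N < m\<^sup>2"
  have "int m dvd lucas_U P ?h" and minus_one: "int m dvd lucas_U P (Suc ?h) + 1"
    using assms(2) lucas_U_double[of P "2 ^ s"] by auto
  have zero: "[lucas_U P ?h = 0] (mod int m)" "[lucas_U P (Suc ?h) = -1] (mod int m)"
    using \<open>int m dvd lucas_U P ?h\<close> minus_one by (auto simp: cong_0_iff cong_iff_dvd_diff)
  have "[lucas_U P (?h + ?h) = 0 * lucas_U P (Suc ?h) + lucas_U P (Suc ?h) * 0 - P * 0 * 0] (mod int m)"
    unfolding lucas_U_add by (intro cong_add cong_diff cong_mult cong_refl zero)
  moreover have "[lucas_U P (Suc (?h + ?h)) = (-1) * (-1) - 0 * 0] (mod int m)"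
    unfolding lucas_U_add by (intro cong_add cong_diff cong_mult cong_refl zero)
  ultimately have N: "lucas_period P (int m) ?N"
    by (simp add: lucas_period_def mult_2)
  obtain d where d: "0 < d" "d < m\<^sup>2" "lucas_period P (int m) d"
    using lucas_period_exists assms(1) by (metis less_trans one_less_numeral_iff semiring_norm(76))
  \<comment> \<open>This gcd is a period smaller than the power of two that it divides, so it divides the half.\<close>
  have "gcd d ?N dvd ?N" by simp
  then obtain e where e: "e \<le> s + 2" "gcd d ?N = 2 ^ e"
    using divides_primepow_nat[OF two_is_prime_nat] by blast
  have "gcd d ?N \<le> d" using d by (simp add: gcd_le1_nat)
  then have "(2::nat) ^ e < 2 ^ (s + 2)" using d small e by linarith
  then have "e < s + 2" by (rule power_less_imp_less_exp[rotated]) simp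
  then have "e \<le> s + 1" by simp
  then have "gcd d ?N dvd ?h" unfolding e by (rule le_imp_power_dvd)
  then have "lucas_period P (int m) ?h"
    using lucas_period_mult[OF lucas_period_gcd[OF d(3) N]]
    by (metis dvd_div_mult_self)
  then have "[1 = lucas_U P (Suc ?h)] (mod int m)"
    by (auto simp: lucas_period_def cong_sym_eq)
  then have "[1 = -1] (mod int m)" using zero(2) cong_trans by blast
  then have "int m dvd 2" by (simp add: cong_iff_dvd_diff)
  then show False using assms(1) zdvd_imp_le by fastforce
qed

section \<open>Three and seven modulo a Fermat prime\<close>

lemma power_two_power_cong_two_or_four:
  "[(2::nat) ^ 2 ^ n = 2] (mod 7) \<or> [(2::nat) ^ 2 ^ n = 4] (mod 7)"
proof (induction n)
  case (Suc n)
  have "(2::nat) ^ 2 ^ Suc n = 2 ^ 2 ^ n * 2 ^ 2 ^ n"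
    by (simp add: power_add[symmetric] mult_2)
  with Suc show ?case by (auto simp: cong_def mod_mult_eq[symmetric, of "2 ^ 2 ^ n"])
qed (simp add: cong_def)

lemma fermat_number_mod:
  assumes "n \<ge> 1"
  shows "fermat_number n mod 4 = 1" "fermat_number n mod 3 = 2"
    "fermat_number n mod 7 \<in> {3, 5}"
proof -
  obtain k where k: "(2::nat) ^ n = 2 * Suc k"
  proof
    show "(2::nat) ^ n = 2 * Suc (2 ^ (n - 1) - 1)"
      using assms by (cases n) auto
  qed
  then have F: "fermat_number n = 4 * 4 ^ k + 1"
    by (simp add: fermat_number_def power_mult)
  show "fermat_number n mod 4 = 1" unfolding F by (simp add: mod_mult_right_eq Suc_times_mod_eq)
  have "(4::nat) ^ k mod 3 = 1" using power_mod[of "4::nat" 3 k] by simp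
  then show "fermat_number n mod 3 = 2" unfolding F by presburger
  show "fermat_number n mod 7 \<in> {3, 5}"
    using power_two_power_cong_two_or_four[of n] unfolding fermat_number_def cong_def
    by (auto simp: mod_Suc)
qed

text \<open>
  The sign in quadratic reciprocity is trivial when one of the primes is 1 modulo 4.
\<close>

lemma Legendre_flip_if_one_mod_four:
  assumes "prime p" "prime q" "2 < q" "p \<noteq> q" "p mod 4 = 1"
  shows "Legendre (int q) (int p) = Legendre (int p) (int q)"
proof -
  have "2 < p" using prime_gt_1_nat[OF assms(1)] assms(5) by (cases "p = 2") auto
  have "even ((p - 1) div 2)" using assms(5) by presburger
  then have "Legendre (int p) (int q) * Legendre (int q) (int p) = 1"
    using Quadratic_Reciprocity[OF assms(1) \<open>2 < p\<close> assms(2,3,4)] by (simp add: power_mult)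
  then show ?thesis by (auto simp: Legendre_def split: if_splits)
qed

lemma square_mod_three: "(y::int)\<^sup>2 mod 3 \<in> {0, 1}"
proof -
  have "y mod 3 \<in> {0, 1, 2}" by auto
  then have "(y mod 3)\<^sup>2 mod 3 \<in> {0, 1}" by auto
  then show ?thesis by (simp add: power_mod)
qed

lemma square_mod_seven: "(y::int)\<^sup>2 mod 7 \<in> {0, 1, 2, 4}"
proof -
  have "y mod 7 \<in> {0, 1, 2, 3, 4, 5, 6}" by auto
  then have "(y mod 7)\<^sup>2 mod 7 \<in> {0, 1, 2, 4}" by auto
  then show ?thesis by (simp add: power_mod)
qed

text \<open>
  By reciprocity it is enough that a Fermat number of positive index is 2 modulo 3, and 3 or 5
  modulo 7, none of which are squares.
\<close>

lemma three_seven_nonresidues_fermat_prime: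
  assumes "n \<ge> 1" "prime (fermat_number n)"
  shows "Legendre 3 (int (fermat_number n)) = -1" "Legendre 7 (int (fermat_number n)) = -1"
proof -
  let ?p = "fermat_number n"
  note res = fermat_number_mod[OF assms(1)]
  have m3: "int ?p mod 3 = 2" using res(2) by presburger
  have m7: "int ?p mod 7 = 3 \<or> int ?p mod 7 = 5" using res(3) by auto presburger+
  have "\<not> QuadRes 3 (int ?p)"
  proof
    assume "QuadRes 3 (int ?p)"
    then obtain y where "y\<^sup>2 mod 3 = int ?p mod 3" by (auto simp: QuadRes_def cong_def)
    then show False using square_mod_three[of y] m3 by simp
  qed
  then have "Legendre (int ?p) 3 = -1"
    using m3 unfolding Legendre_def cong_def by auto
  moreover have "?p \<noteq> 3" using res(2) by auto
  ultimately show "Legendre 3 (int ?p) = -1"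
    using Legendre_flip_if_one_mod_four[of ?p 3] assms(2) res(1) by simp
  have "\<not> QuadRes 7 (int ?p)"
  proof
    assume "QuadRes 7 (int ?p)"
    then obtain y where "y\<^sup>2 mod 7 = int ?p mod 7" by (auto simp: QuadRes_def cong_def)
    then show False using square_mod_seven[of y] m7 by auto
  qed
  then have "Legendre (int ?p) 7 = -1"
    using m7 unfolding Legendre_def cong_def by auto
  moreover have "?p \<noteq> 7" using res(3) by auto
  ultimately show "Legendre 7 (int ?p) = -1"
    using Legendre_flip_if_one_mod_four[of ?p 7] assms(2) res(1) by simp
qed

section \<open>The primality test\<close>

lemma iterate_eq_lucas_V:
  assumes "S 0 = (P::int)" "\<And>i. i \<in> {1..r} \<Longrightarrow> S i = (S (i - 1))\<^sup>2 - 2" "i \<le> r"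
  shows "S i = lucas_V P (2 ^ i)"
  using assms(3)
proof (induction i)
  case 0
  show ?case using assms(1) by (simp add: lucas_V_def)
next
  case (Suc i)
  then show ?case using assms(2)[of "Suc i"] by (simp add: lucas_V_double)
qed

lemma lucas_V_cong_power_sum:
  assumes "[a + b = P] (mod m)" "[a * b = 1] (mod m)"
  shows "[lucas_V P (2 ^ i) = a ^ 2 ^ i + b ^ 2 ^ i] (mod m)"
proof (induction i)
  case 0
  show ?case using assms(1) by (simp add: lucas_V_def cong_sym_eq)
next
  case (Suc i)
  let ?x = "a ^ 2 ^ i" and ?y = "b ^ 2 ^ i"
  have xy: "[?x * ?y = 1] (mod m)"
    using cong_pow[OF assms(2), of "2 ^ i"] by (simp add: power_mult_distrib)
  have "[lucas_V P (2 ^ Suc i) = (?x + ?y)\<^sup>2 - 2 * 1] (mod m)"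
    using cong_diff[OF cong_pow[OF Suc, of 2] cong_refl[of 2]] by (simp add: lucas_V_double)
  also have "[(?x + ?y)\<^sup>2 - 2 * 1 = (?x + ?y)\<^sup>2 - 2 * (?x * ?y)] (mod m)"
    by (intro cong_diff cong_mult cong_refl cong_sym[OF xy])
  also have "(?x + ?y)\<^sup>2 - 2 * (?x * ?y) = ?x\<^sup>2 + ?y\<^sup>2"
    by (simp add: power2_sum)
  also have "\<dots> = a ^ 2 ^ Suc i + b ^ 2 ^ Suc i"
    by (simp only: power_Suc2 power_mult)
  finally show ?case .
qed

text \<open>
  The roots of \<open>X\<^sup>2 - 5 X + 1\<close> lie in the prime field because \<open>21 = 3 * 7\<close>, the product of two
  nonresidues, is a square there.  The root \<open>a\<close> is a nonresidue because \<open>3 * 2\<^sup>2 * a\<close> is a nonzero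
  square; by Euler's criterion \<open>a ^ (2 * 2 ^ r) = -1\<close>, and dividing by \<open>a ^ 2 ^ r\<close> shows that
  \<open>a ^ 2 ^ r + b ^ 2 ^ r\<close> vanishes.
\<close>

lemma lucas_test_if_prime:
  assumes "prime p" "p = 2 ^ (r + 2) + 1"
    and "Legendre 3 (int p) = -1" "Legendre 7 (int p) = -1"
  shows "int p dvd lucas_V 5 (2 ^ r)"
proof -
  let ?m = "int p" and ?e = "2 ^ (r + 1) :: nat"
  have "p = 4 * 2 ^ r + 1" using assms(2) by simp
  moreover have "(1::nat) \<le> 2 ^ r" by simp
  ultimately have "2 < p" by linarith
  have e: "(p - 1) div 2 = ?e" using assms(2) by simp
  have euler: "[Legendre x ?m = x ^ ?e] (mod ?m)" for x
    using euler_criterion[OF assms(1) \<open>2 < p\<close>, of x] e by simp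
  have fermat: "[y ^ (2 * ?e) = 1] (mod ?m)" if "\<not> ?m dvd y" for y
  proof -
    have "(Legendre y ?m)\<^sup>2 = 1" using that by (auto simp: Legendre_def cong_0_iff)
    then show ?thesis
      using cong_sym[OF cong_pow[OF euler[of y], of 2]] unfolding power_mult[symmetric] mult.commute[of 2]
      by metis
  qed
  have "[3 ^ ?e * 7 ^ ?e = Legendre 3 ?m * Legendre 7 ?m] (mod ?m)"
    by (intro cong_mult cong_sym[OF euler])
  then have "[21 ^ ?e = 1] (mod ?m)"
    using assms(3,4) by (simp flip: power_mult_distrib)
  then have "[Legendre 21 ?m = 1] (mod ?m)"
    using euler cong_trans by blast
  then have "QuadRes ?m 21"
    using \<open>2 < p\<close> by (auto simp: Legendre_def cong_iff_dvd_diff split: if_splits dest!: zdvd_imp_le)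
  then obtain t where t: "[t\<^sup>2 = 21] (mod ?m)" by (auto simp: QuadRes_def)
  \<comment> \<open>\<open>c\<close> is the inverse of 2 modulo \<open>p\<close>, namely \<open>(p + 1) / 2\<close>.\<close>
  define c where "c = 2 ^ (r + 1) + (1::int)"
  have "2 * c = ?m + 1" using assms(2) by (simp add: c_def)
  then have c: "[2 * c = 1] (mod ?m)" by (simp add: cong_iff_dvd_diff)
  define a b where "a = c * (5 + t)" and "b = c * (5 - t)"
  have "[2 * c * 5 = 1 * 5] (mod ?m)" by (intro cong_mult c cong_refl)
  then have sum: "[a + b = 5] (mod ?m)" by (simp add: a_def b_def algebra_simps)
  have "a * b = c\<^sup>2 * (25 - t\<^sup>2)"
    by (simp add: a_def b_def power2_eq_square algebra_simps)
  also have "[c\<^sup>2 * (25 - t\<^sup>2) = c\<^sup>2 * (25 - 21)] (mod ?m)"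
    by (intro cong_mult cong_diff cong_refl t)
  also have "c\<^sup>2 * (25 - 21) = (2 * c)\<^sup>2" by (simp add: power2_eq_square)
  also have "[(2 * c)\<^sup>2 = 1\<^sup>2] (mod ?m)" by (intro cong_pow c)
  finally have prod: "[a * b = 1] (mod ?m)" by simp
  have "3 * 2\<^sup>2 * a = 2 * c * (6 * (5 + t))" by (simp add: a_def)
  also have "[2 * c * (6 * (5 + t)) = 1 * (6 * (5 + t))] (mod ?m)"
    by (intro cong_mult c cong_refl)
  also have "1 * (6 * (5 + t)) = 9 + 6 * t + 21" by simp
  also have "[9 + 6 * t + 21 = 9 + 6 * t + t\<^sup>2] (mod ?m)"
    by (intro cong_add cong_refl cong_sym[OF t])
  also have "9 + 6 * t + t\<^sup>2 = (3 + t)\<^sup>2" by (simp add: power2_eq_square algebra_simps)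
  finally have sq: "[3 * 2\<^sup>2 * a = (3 + t)\<^sup>2] (mod ?m)" .
  \<comment> \<open>The square is nonzero: \<open>t = -3\<close> would give \<open>21 = 9\<close>, that is \<open>p\<close> dividing 12.\<close>
  have not3: "\<not> ?m dvd 3"
    using assms(3) by (auto simp: Legendre_def cong_0_iff split: if_splits)
  have not2: "\<not> ?m dvd 2" using \<open>2 < p\<close> zdvd_imp_le by fastforce
  have not3t: "\<not> ?m dvd 3 + t"
  proof
    assume "?m dvd 3 + t"
    then have "?m dvd (3 + t) * (3 - t) + (t\<^sup>2 - 21)"
      using t by (auto simp: cong_iff_dvd_diff)
    also have "(3 + t) * (3 - t) + (t\<^sup>2 - 21) = - (2 * 2 * 3)"
      by (simp add: power2_eq_square algebra_simps)
    finally have "?m dvd 2 * 2 * 3" by (simp only: dvd_minus_iff)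
    then show False
      using assms(1) not2 not3 prime_dvd_mult_iff[of ?m] by (metis prime_int_nat_transfer prime_nat_int_transfer)
  qed
  have "[- 1 * 1 * a ^ ?e = 3 ^ ?e * 2 ^ (2 * ?e) * a ^ ?e] (mod ?m)"
    using euler[of 3] assms(3) fermat[OF not2, THEN cong_sym]
    by (intro cong_mult cong_refl) auto
  also have "3 ^ ?e * 2 ^ (2 * ?e) * a ^ ?e = (3 * 2\<^sup>2 * a) ^ ?e"
    by (simp only: power_mult power_mult_distrib)
  also have "[(3 * 2\<^sup>2 * a) ^ ?e = ((3 + t)\<^sup>2) ^ ?e] (mod ?m)"
    by (rule cong_pow[OF sq])
  also have "((3 + t)\<^sup>2) ^ ?e = (3 + t) ^ (2 * ?e)" by (simp only: power_mult)
  also have "[(3 + t) ^ (2 * ?e) = 1] (mod ?m)" by (rule fermat[OF not3t])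
  finally have "?m dvd - (a ^ ?e + 1)" by (simp add: cong_iff_dvd_diff)
  then have nonres: "?m dvd a ^ ?e + 1" by (simp only: dvd_minus_iff)
  let ?x = "a ^ 2 ^ r" and ?y = "b ^ 2 ^ r"
  have xy: "[?x * ?y = 1] (mod ?m)"
    using cong_pow[OF prod, of "2 ^ r"] by (simp add: power_mult_distrib)
  have "[?x + ?y = ?x * (?x * ?y) + ?y * 1] (mod ?m)"
    using cong_mult[OF cong_refl[of ?x] cong_sym[OF xy]] by (intro cong_add) auto
  also have "?x * (?x * ?y) + ?y * 1 = (a ^ ?e + 1) * ?y"
    by (simp add: algebra_simps power_add mult_2)
  also have "[(a ^ ?e + 1) * ?y = 0] (mod ?m)"
    using nonres by (simp add: cong_0_iff)
  finally have "[lucas_V 5 (2 ^ r) = 0] (mod ?m)"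
    using lucas_V_cong_power_sum[OF sum prod, of r] cong_trans by blast
  then show ?thesis by (simp add: cong_0_iff)
qed

lemma smaller_factor_if_not_prime:
  fixes N :: nat
  assumes "\<not> prime N" "1 < N"
  obtains x y where "N = x * y" "1 < x" "x \<le> y"
proof -
  obtain z where z: "z dvd N" "z \<noteq> 1" "z \<noteq> N"
    using assms prime_nat_iff by blast
  then obtain w where w: "N = z * w" by blast
  have "z \<noteq> 0" "w \<noteq> 0" using w assms(2) by (metis mult_is_0 not_less_zero)+
  moreover have "w \<noteq> 1" using w z(3) by (metis mult.right_neutral)
  ultimately have "1 < z" "1 < w" using z(2) by linarith+
  show thesis
  proof (cases "z \<le> w")
    case True
    show thesis by (rule that[OF w \<open>1 < z\<close> True])
  next
    case False
    have "N = w * z" unfolding w by (rule mult.commute)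
    then show thesis using False \<open>1 < w\<close> by (intro that) auto
  qed
qed

text \<open>
  The period bound applied to the smaller factor \<open>x\<close> of \<open>N\<close> gives \<open>N - 1 < x\<^sup>2 \<le> N\<close>, so \<open>x\<^sup>2 = N\<close>.
  For even \<open>r\<close> this is absurd, since then \<open>N - 1\<close> is a positive square as well.
\<close>

lemma prime_if_lucas_test:
  assumes "N = 2 ^ (r + 2) + 1" and "even r" and "int N dvd lucas_V P (2 ^ r)"
  shows "prime N"
proof (rule ccontr)
  assume "\<not> prime N"
  obtain j where j: "r = 2 * j" using \<open>even r\<close> by blast
  have N: "N = (2 ^ (j + 1))\<^sup>2 + 1"
    using assms(1) j by (simp add: power_even_eq power_add flip: power_mult)
  then have "N > 1" by simp
  with \<open>\<not> prime N\<close> obtain x y where xy: "N = x * y" "1 < x" "x \<le> y"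
    using smaller_factor_if_not_prime by blast
  have "x\<^sup>2 \<le> N" using xy by (simp add: power2_eq_square)
  have "odd N" using assms(1) by simp
  then have "x \<noteq> 2" using xy by auto
  then have "2 < x" using xy by simp
  moreover have "int x dvd lucas_V P (2 ^ r)"
    using xy(1) assms(3) by (metis dvd_trans dvd_triv_left of_nat_mult)
  ultimately have "2 ^ (r + 2) < x\<^sup>2"
    by (rule power_two_less_square_if_dvd_lucas_V)
  with \<open>x\<^sup>2 \<le> N\<close> have "x\<^sup>2 = (2 ^ (j + 1))\<^sup>2 + 1" using assms(1) N by linarith
  moreover have "z\<^sup>2 + 1 < (z + 1)\<^sup>2" if "0 < z" for z :: nat
    using that by (simp add: power2_eq_square)
  ultimately have between: "x\<^sup>2 < (2 ^ (j + 1) + 1)\<^sup>2" "(2 ^ (j + 1))\<^sup>2 < x\<^sup>2"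
    by (simp_all only: less_add_one zero_less_power pos2)
  have "x < 2 ^ (j + 1) + 1" by (rule power_less_imp_less_base[OF between(1)]) simp
  moreover have "2 ^ (j + 1) < x" by (rule power_less_imp_less_base[OF between(2)]) simp
  ultimately show False by linarith
qed

theorem theorem1:
  fixes n :: nat and S :: "nat \<Rightarrow> int"
  assumes "n \<ge> 1"
    and "S 0 = 5"
    and "\<And>i. i \<in> {1..2 ^ n - 2} \<Longrightarrow> S i = (S (i - 1))\<^sup>2 - 2"
  shows "prime (fermat_number n) \<longleftrightarrow> int (fermat_number n) dvd S (2 ^ n - 2)"
proof -
  define r :: nat where "r = 2 ^ n - 2"
  have "(2::nat) \<le> 2 ^ n" using power_increasing[of 1 n "2::nat"] assms(1) by simp
  then have r: "2 ^ n = r + 2" by (simp add: r_def)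
  then have F: "fermat_number n = 2 ^ (r + 2) + 1"
    by (simp only: fermat_number_def)
  have "even r" using assms(1) by (simp add: r_def)
  have S: "S r = lucas_V 5 (2 ^ r)"
    by (rule iterate_eq_lucas_V[of S 5 r r, OF assms(2) assms(3)[folded r_def] order_refl])
  show ?thesis
    unfolding r_def[symmetric] S
  proof
    assume "prime (fermat_number n)"
    then show "int (fermat_number n) dvd lucas_V 5 (2 ^ r)"
      using three_seven_nonresidues_fermat_prime[OF assms(1)] by (intro lucas_test_if_prime F)
  next
    assume "int (fermat_number n) dvd lucas_V 5 (2 ^ r)"
    then show "prime (fermat_number n)"
      by (rule prime_if_lucas_test[OF F \<open>even r\<close>])
  qed
qed

end
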